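(* Let $\lambda\in R\cup\{\infty\}$ (with $\alpha_1\geq 1$ if $\lambda=\infty$) be such that $\Phi$ does not vanish along $L_\lambda\setminus\{(0,0)\}$, and let $\Psi$ be the function, associated with $\lambda$ and a point of $L_\lambda$ where $\Phi=1$, defined in the context. Then there exists a smallest integer $M^\lambda\ge2$ such that $\Psi^{(M^\lambda)}(0)\ne0$. More concretely, if $\lambda\ne\infty$ then $M^\lambda=\omega_\lambda+2$, and if $\lambda=\infty$ then $M^\lambda=\alpha_1+2$.
   Context: Let $m\ge2$ be an integer and let $\Phi\in\mathbb R[x_1,x_2]$ be a nonzero homogeneous polynomial of degree $m$. Standing assumption: $\Phi$ is not a constant multiple of the $m$-th power of a real linear form. Let $H\Phi=\partial_{11}\Phi\,\partial_{22}\Phi-(\partial_{12}\Phi)^2$ be the Hessian determinant. Write $H\Phi(x_1,x_2)=x_1^{\alpha_1}\prod_{\lambda\in R}(x_2-\lambda x_1)^{\omega_\lambda}Q(x_1,x_2)$, where $R\subset\mathbb R$ is the finite set of real $\lambda$ (possibly including $0$) with $H\Phi(1,\lambda)=0$, $\omega_\lambda\ge1$, and $Q\neq0$ away from the origin. For $\lambda\in R$ let $L_\lambda=\{x_2=\lambda x_1\}$; let $L_\infty=\{x_1=0\}$ if $\alpha_1\neq0$. Definition of $\Psi$. Choose $(x_1^0,x_2^0)\in L_\lambda\setminus\{(0,0)\}$ with $\Phi(x_1^0,x_2^0)=1$ (so $H\Phi(x_1^0,x_2^0)=0$). If $\lambda<\infty$, put $z_1^0=x_1^0$ and $\Phi_\lambda(z_1,z_2)=\Phi(z_1,z_2+\lambda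 z_1)$. If $\lambda=\infty$, put $z_1^0=x_2^0$ and $\Phi_\infty(z_1,z_2)=\Phi(z_2,z_1)$. By homogeneity $z_1^0\,\partial_1\Phi_\lambda(z_1^0,0)=m\Phi_\lambda(z_1^0,0)=m\neq0$, so by the implicit function theorem there is, for some small $\epsilon_0>0$, a unique smooth function $\Psi:(-\epsilon_0,\epsilon_0)\to\mathbb R$ with $\Psi(0)=z_1^0$ and $\Phi_\lambda(\Psi(z_2),z_2)=1$ for $|z_2|<\epsilon_0$. *)

theory Defs
  imports "HOL-Analysis.Analysis" "HOL-Computational_Algebra.Polynomial"
begin

text \<open>
  The ring $R[x_1,x_2]$ of real polynomials in two variables is represented as
  $(R[x_1])[x_2]$, that is, as \<^typ>\<open>real poly poly\<close>: the coefficient of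
  $x_1^i x_2^j$ in \<open>P\<close> is \<open>coeff (coeff P j) i\<close>.
\<close>

type_synonym bipoly = "real poly poly"

definition Const :: "real \<Rightarrow> bipoly" where
  "Const c = [:[:c:]:]"

definition X1 :: bipoly where
  "X1 = [:[:0, 1:]:]"

definition X2 :: bipoly where
  "X2 = [:0, 1:]"

definition eval2 :: "bipoly \<Rightarrow> real \<Rightarrow> real \<Rightarrow> real" where
  "eval2 P x1 x2 = poly (poly P [:x2:]) x1"

definition homogeneous :: "nat \<Rightarrow> bipoly \<Rightarrow> bool" where
  "homogeneous m P \<longleftrightarrow> (\<forall>i j. coeff (coeff P j) i \<noteq> 0 \<longrightarrow> i + j = m)"

definition D1 :: "bipoly \<Rightarrow> bipoly" where
  "D1 P = map_poly pderiv P"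

definition D2 :: "bipoly \<Rightarrow> bipoly" where
  "D2 P = pderiv P"

definition hessian_det :: "bipoly \<Rightarrow> bipoly" where
  "hessian_det P = D1 (D1 P) * D2 (D2 P) - (D1 (D2 P))\<^sup>2"

text \<open>
  \<open>R\<close>, \<open>\<alpha>1\<close>, \<open>\<omega>\<close> and \<open>Q\<close> are the data of the factorization of the polynomial \<open>H\<close>
  into its real linear factors and a factor without real zeros. Only the values of
  \<open>\<omega>\<close> on \<open>R\<close> matter.
\<close>

definition root_factorization ::
    "bipoly \<Rightarrow> nat \<Rightarrow> real set \<Rightarrow> (real \<Rightarrow> nat) \<Rightarrow> bipoly \<Rightarrow> bool" where
  "root_factorization H \<alpha>1 R \<omega> Q \<longleftrightarrow>
     R = {l. eval2 H 1 l = 0} \<and> finite R \<and>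
     (\<forall>l\<in>R. 1 \<le> \<omega> l) \<and>
     H = X1 ^ \<alpha>1 * (\<Prod>l\<in>R. (X2 - Const l * X1) ^ \<omega> l) * Q \<and>
     (\<forall>x1 x2. (x1, x2) \<noteq> (0, 0) \<longrightarrow> eval2 Q x1 x2 \<noteq> 0)"

datatype slope = Fin real | Infty

fun line :: "slope \<Rightarrow> (real \<times> real) set" where
  "line (Fin l) = {(x1, x2). x2 = l * x1}"
| "line Infty = {(x1, x2). x1 = 0}"

text \<open>
  \<open>base_coord s (x\<^sub>1\<^sup>0, x\<^sub>2\<^sup>0)\<close> is $z_1^0$, and \<open>rotated \<Phi> s\<close> is the function
  $\Phi_\lambda$, in whose coordinates the line becomes $z_2 = 0$.
\<close>

fun base_coord :: "slope \<Rightarrow> real \<times> real \<Rightarrow> real" where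
  "base_coord (Fin l) p = fst p"
| "base_coord Infty p = snd p"

fun rotated :: "bipoly \<Rightarrow> slope \<Rightarrow> real \<Rightarrow> real \<Rightarrow> real" where
  "rotated \<Phi> (Fin l) z1 z2 = eval2 \<Phi> z1 (z2 + l * z1)"
| "rotated \<Phi> Infty z1 z2 = eval2 \<Phi> z2 z1"

text \<open>Meant for open sets \<open>S\<close>, where the values of \<open>f\<close> outside \<open>S\<close> are irrelevant.\<close>

definition smooth_on :: "real set \<Rightarrow> (real \<Rightarrow> real) \<Rightarrow> bool" where
  "smooth_on S f \<longleftrightarrow> (\<forall>n. \<forall>x\<in>S. (deriv ^^ n) f field_differentiable (at x))"

text \<open>
  \<open>\<Psi>\<close> is the local parametrization, on \<open>(-\<epsilon>, \<epsilon>)\<close>, of the level set \<open>\<Phi> = 1\<close> near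
  the point \<open>p\<close> of the line of slope \<open>s\<close>.
\<close>

definition level_param ::
    "bipoly \<Rightarrow> slope \<Rightarrow> real \<times> real \<Rightarrow> real \<Rightarrow> (real \<Rightarrow> real) \<Rightarrow> bool" where
  "level_param \<Phi> s p \<epsilon> \<Psi> \<longleftrightarrow>
     p \<in> line s - {(0, 0)} \<and> eval2 \<Phi> (fst p) (snd p) = 1 \<and>
     0 < \<epsilon> \<and> smooth_on {-\<epsilon><..<\<epsilon>} \<Psi> \<and> \<Psi> 0 = base_coord s p \<and>
     (\<forall>z2\<in>{-\<epsilon><..<\<epsilon>}. rotated \<Phi> s (\<Psi> z2) z2 = 1)"

end

theory Submission
  imports Defs
begin

text \<open>
  The order of vanishing of \<open>\<Psi>''\<close> at 0 is the multiplicity of the line in the Hessian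
  determinant, because along a level curve of a homogeneous function the Hessian determinant is
  the curvature up to a factor without zeros.

  Let \<open>\<gamma> = (x, y)\<close> run on the curve \<open>\<Phi> = 1\<close> and let \<open>W = x y' - y x'\<close>. Write the Hessian form of
  \<open>\<Phi>\<close> at \<open>\<gamma>\<close> in the basis \<open>\<gamma>, \<gamma>'\<close>. By Euler's relations it takes the values
  \<open>m (m - 1)\<close> on \<open>(\<gamma>, \<gamma>)\<close> and 0 on \<open>(\<gamma>, \<gamma>')\<close>, the latter because \<open>\<gamma>'\<close> is tangent to the level curve. On
  \<open>(\<gamma>', \<gamma>')\<close> it is \<open>- d\<Phi>(\<gamma>'')\<close>, by differentiating \<open>\<Phi>(\<gamma>) = 1\<close> twice. Since \<open>W d\<Phi> = m (y', - x')\<close>,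
  comparing determinants gives
  \<open>H\<Phi>(\<gamma>) W^3 = m^2 (m - 1) (x' y'' - y' x'')\<close>, which is
  \<open>homogeneous_level_curve_hessian\<close>.

  For a finite slope \<open>l\<close> take \<open>\<gamma>(t) = (\<Psi>(t), t + l \<Psi>(t))\<close>, so that \<open>x' y'' - y' x'' = - \<Psi>''\<close>; the factor
  \<open>x2 - l x1\<close> of the Hessian determinant equals \<open>t\<close> on this curve, and the other factors do not vanish
  at \<open>t = 0\<close>. For the infinite slope take \<open>\<gamma>(t) = (t, \<Psi>(t))\<close>, where \<open>x' y'' - y' x'' = \<Psi>''\<close> and the
  factor \<open>x1\<close> equals \<open>t\<close>. Either way \<open>\<Psi>''(t) = t^n B(t)\<close> with \<open>B\<close> continuous and nonzero at 0
  (\<open>level_param_second_deriv\<close>), and by Taylor's theorem the first derivative of \<open>\<Psi>''\<close>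
  that does not vanish at 0 is the one of order \<open>n\<close> (\<open>deriv_order_of_zero\<close>).
\<close>

section \<open>Partial derivatives of bivariate polynomials\<close>

lemma eval2_add: "eval2 (P + Q) x y = eval2 P x y + eval2 Q x y"
  and eval2_diff: "eval2 (P - Q) x y = eval2 P x y - eval2 Q x y"
  and eval2_mult: "eval2 (P * Q) x y = eval2 P x y * eval2 Q x y"
  and eval2_power: "eval2 (P ^ n) x y = eval2 P x y ^ n"
  and eval2_of_nat: "eval2 (of_nat n) x y = real n"
  and eval2_Const: "eval2 (Const c) x y = c"
  and eval2_X1: "eval2 X1 x y = x"
  and eval2_X2: "eval2 X2 x y = y"
  by (simp_all add: eval2_def Const_def X1_def X2_def of_nat_poly)

lemma eval2_prod: "eval2 (\<Prod>i\<in>I. f i) x y = (\<Prod>i\<in>I. eval2 (f i) x y)"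
  by (simp add: eval2_def poly_prod)

lemmas eval2_simps =
  eval2_add eval2_diff eval2_mult eval2_power eval2_of_nat eval2_Const eval2_X1 eval2_X2 eval2_prod

lemma coeff_D1: "coeff (coeff (D1 P) j) i = real (Suc i) * coeff (coeff P j) (Suc i)"
  by (simp add: D1_def coeff_map_poly coeff_pderiv)

lemma coeff_D2: "coeff (coeff (D2 P) j) i = real (Suc j) * coeff (coeff P (Suc j)) i"
  by (simp add: D2_def coeff_pderiv of_nat_poly)

lemma D2_D1_commute: "D2 (D1 P) = D1 (D2 P)"
  by (intro poly_eqI) (simp add: coeff_D1 coeff_D2)

lemma homogeneous_D1: "homogeneous m P \<Longrightarrow> homogeneous (m - 1) (D1 P)"
  unfolding homogeneous_def coeff_D1 by fastforce

lemma homogeneous_D2: "homogeneous m P \<Longrightarrow> homogeneous (m - 1) (D2 P)"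
  unfolding homogeneous_def coeff_D2 by fastforce

text \<open>
  Euler's relation holds monomial by monomial: the operator multiplies the coefficient of
  \<open>x1^i x2^j\<close> by \<open>i + j\<close>.
\<close>

lemma euler_homogeneous:
  assumes "homogeneous m P"
  shows "x * eval2 (D1 P) x y + y * eval2 (D2 P) x y = real m * eval2 P x y"
proof -
  have "coeff (coeff (X1 * D1 P + X2 * D2 P) j) i = coeff (coeff (of_nat m * P) j) i" for i j
  proof -
    have "coeff (coeff (X1 * D1 P) j) i = real i * coeff (coeff P j) i"
      by (cases i) (simp_all add: X1_def coeff_D1)
    moreover have "coeff (coeff (X2 * D2 P) j) i = real j * coeff (coeff P j) i"
      by (cases j) (simp_all add: X2_def coeff_D2)
    moreover have "coeff (coeff P j) i = 0 \<or> real i + real j = real m"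
      using assms unfolding homogeneous_def by (metis of_nat_add)
    ultimately show ?thesis
      by (auto simp: of_nat_poly simp flip: distrib_right)
  qed
  then have "X1 * D1 P + X2 * D2 P = of_nat m * P"
    by (intro poly_eqI)
  from arg_cong[OF this, of "\<lambda>P. eval2 P x y"] show ?thesis
    by (simp add: eval2_simps)
qed

lemma DERIV_eval2:
  assumes x: "(x has_real_derivative x') (at t)" and y: "(y has_real_derivative y') (at t)"
  shows "((\<lambda>t. eval2 P (x t) (y t)) has_real_derivative
           eval2 (D1 P) (x t) (y t) * x' + eval2 (D2 P) (x t) (y t) * y') (at t)"
proof (induction P)
  case 0
  then show ?case by (simp add: eval2_def D1_def D2_def)
next
  case (pCons a P)
  have e: "eval2 (pCons a P) u v = poly a u + v * eval2 P u v" for u v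
    by (simp add: eval2_def)
  have e1: "eval2 (D1 (pCons a P)) u v = poly (pderiv a) u + v * eval2 (D1 P) u v" for u v
    by (simp add: eval2_def D1_def map_poly_pCons)
  have e2: "eval2 (D2 (pCons a P)) u v = eval2 P u v + v * eval2 (D2 P) u v" for u v
    by (simp add: eval2_def D2_def pderiv_pCons)
  have "((\<lambda>t. poly a (x t)) has_real_derivative poly (pderiv a) (x t) * x') (at t)"
    using DERIV_chain2[OF poly_DERIV x] .
  from DERIV_add[OF this DERIV_mult[OF y pCons.IH]] show ?case
    by (simp add: e e1 e2 algebra_simps)
qed

section \<open>The Hessian determinant along a level curve\<close>

text \<open>
  The right-hand side is the numerator of the curvature of the curve. The identity avoids
  division by a partial derivative of \<open>\<Phi>\<close>, so it applies to every parametrization, graphs over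
  either axis included. \<open>W\<close> vanishes only where the velocity does, since the position is
  transversal to the level curve by Euler's relation.
\<close>

lemma homogeneous_level_curve_hessian:
  assumes \<Phi>: "homogeneous m \<Phi>" and m: "2 \<le> m"
    and S: "open S" "t \<in> S"
    and x: "\<And>t. t \<in> S \<Longrightarrow> (x has_real_derivative x' t) (at t)"
    and y: "\<And>t. t \<in> S \<Longrightarrow> (y has_real_derivative y' t) (at t)"
    and x': "(x' has_real_derivative x'') (at t)"
    and y': "(y' has_real_derivative y'') (at t)"
    and level: "\<And>t. t \<in> S \<Longrightarrow> eval2 \<Phi> (x t) (y t) = 1"
  defines "W \<equiv> x t * y' t - y t * x' t"
  shows "eval2 (hessian_det \<Phi>) (x t) (y t) * W ^ 3
           = (real m)\<^sup>2 * (real m - 1) * (x' t * y'' - y' t * x'')"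
    and "W = 0 \<Longrightarrow> x' t = 0 \<and> y' t = 0"
proof -
  let ?e = "\<lambda>P. eval2 P (x t) (y t)"
  define X Y U V n p q a b c where defs:
    "X = x t" "Y = y t" "U = x' t" "V = y' t" "n = real m"
    "p = ?e (D1 \<Phi>)" "q = ?e (D2 \<Phi>)"
    "a = ?e (D1 (D1 \<Phi>))" "b = ?e (D1 (D2 \<Phi>))" "c = ?e (D2 (D2 \<Phi>))"
  have ev: "\<forall>\<^sub>F s in nhds t. s \<in> S" using S by (simp add: eventually_nhds_in_open)
  have first: "eval2 (D1 \<Phi>) (x s) (y s) * x' s + eval2 (D2 \<Phi>) (x s) (y s) * y' s = 0"
    if "s \<in> S" for s
  proof -
    have "\<forall>\<^sub>F r in nhds s. eval2 \<Phi> (x r) (y r) = 1"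
      using eventually_nhds_in_open[OF S(1) that] by eventually_elim (rule level)
    then have "((\<lambda>r. eval2 \<Phi> (x r) (y r)) has_real_derivative 0) (at s)"
      by (subst DERIV_cong_ev[OF refl _ refl]) auto
    with DERIV_eval2[OF x[OF that] y[OF that]] show ?thesis
      by (rule DERIV_unique)
  qed
  have C1: "p * U + q * V = 0" using first[OF S(2)] by (simp add: defs)
  have C2: "a * U\<^sup>2 + 2 * b * U * V + c * V\<^sup>2 + p * x'' + q * y'' = 0"
  proof -
    have "\<forall>\<^sub>F s in nhds t.
        eval2 (D1 \<Phi>) (x s) (y s) * x' s + eval2 (D2 \<Phi>) (x s) (y s) * y' s = 0"
      using ev by eventually_elim (rule first)
    then have "((\<lambda>s. eval2 (D1 \<Phi>) (x s) (y s) * x' s + eval2 (D2 \<Phi>) (x s) (y s) * y' s)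
                 has_real_derivative 0) (at t)"
      by (subst DERIV_cong_ev[OF refl _ refl]) auto
    from DERIV_unique[OF DERIV_add[OF
          DERIV_mult[OF DERIV_eval2[OF x[OF S(2)] y[OF S(2)]] x']
          DERIV_mult[OF DERIV_eval2[OF x[OF S(2)] y[OF S(2)]] y']] this]
    show ?thesis
      by (simp add: defs D2_D1_commute power2_eq_square algebra_simps)
  qed
  have E0: "X * p + Y * q = n"
    using euler_homogeneous[OF \<Phi>, of "x t" "y t"] level[OF S(2)] by (simp add: defs)
  have E1: "X * a + Y * b = (n - 1) * p"
    using euler_homogeneous[OF homogeneous_D1[OF \<Phi>], of "x t" "y t"] m
    by (simp add: defs D2_D1_commute of_nat_diff)
  have E2: "X * b + Y * c = (n - 1) * q"
    using euler_homogeneous[OF homogeneous_D2[OF \<Phi>], of "x t" "y t"] m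
    by (simp add: defs of_nat_diff)
  have W: "W = X * V - Y * U" by (simp add: W_def defs)
  have "p * W = (X * p + Y * q) * V - Y * (p * U + q * V)"
    by (simp add: W algebra_simps)
  then have pW: "p * W = n * V" by (simp add: E0 C1)
  have "q * W = X * (p * U + q * V) - (X * p + Y * q) * U"
    by (simp add: W algebra_simps)
  then have qW: "q * W = - n * U" by (simp add: E0 C1)
  show "W = 0 \<Longrightarrow> x' t = 0 \<and> y' t = 0"
    using pW qW m by (simp add: defs)
  \<comment> \<open>A change of basis to (position, velocity) multiplies the determinant of the Hessian form by
    the square of \<open>W\<close>; Euler's relations make the new matrix diagonal.\<close>
  have "(a * c - b\<^sup>2) * W\<^sup>2 =
      (a * X\<^sup>2 + 2 * b * X * Y + c * Y\<^sup>2) * (a * U\<^sup>2 + 2 * b * U * V + c * V\<^sup>2)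
        - ((X * a + Y * b) * U + (X * b + Y * c) * V)\<^sup>2"
    by (simp add: W power2_eq_square algebra_simps)
  also have "(X * a + Y * b) * U + (X * b + Y * c) * V = (n - 1) * (p * U + q * V)"
    by (simp add: E1 E2 algebra_simps)
  also have "\<dots> = 0" by (simp add: C1)
  also have "a * X\<^sup>2 + 2 * b * X * Y + c * Y\<^sup>2 = X * (X * a + Y * b) + Y * (X * b + Y * c)"
    by (simp add: power2_eq_square algebra_simps)
  also have "\<dots> = (n - 1) * (X * p + Y * q)" by (simp add: E1 E2 algebra_simps)
  also have "\<dots> = n * (n - 1)" by (simp add: E0)
  also have "a * U\<^sup>2 + 2 * b * U * V + c * V\<^sup>2 = - (p * x'' + q * y'')"
    using C2 by linarith
  finally have det: "(a * c - b\<^sup>2) * W\<^sup>2 = n * (n - 1) * - (p * x'' + q * y'')" by simp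
  have "(a * c - b\<^sup>2) * W ^ 3 = (a * c - b\<^sup>2) * W\<^sup>2 * W"
    by (simp add: power3_eq_cube power2_eq_square)
  also have "\<dots> = n * (n - 1) * - ((p * W) * x'' + (q * W) * y'')"
    unfolding det by (simp add: algebra_simps)
  also have "\<dots> = n\<^sup>2 * (n - 1) * (U * y'' - V * x'')"
    unfolding pW qW by (simp add: power2_eq_square algebra_simps)
  finally have "(a * c - b\<^sup>2) * W ^ 3 = n\<^sup>2 * (n - 1) * (U * y'' - V * x'')" .
  then show "eval2 (hessian_det \<Phi>) (x t) (y t) * W ^ 3
           = (real m)\<^sup>2 * (real m - 1) * (x' t * y'' - y' t * x'')"
    by (simp add: defs hessian_det_def eval2_simps)
qed

section \<open>Derivatives at a zero of finite order\<close>

lemma DERIV_smooth_on: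
  assumes "smooth_on S f" "x \<in> S"
  shows "((deriv ^^ n) f has_real_derivative (deriv ^^ Suc n) f x) (at x)"
  using assms by (auto simp: smooth_on_def field_differentiable_derivI)

text \<open>
  The leading term of the Taylor expansion, from l'Hospital's rule: one step passes from \<open>f\<close> and
  \<open>n + 1\<close> to \<open>f'\<close> and \<open>n\<close>.
\<close>

lemma taylor_quotient_tendsto:
  fixes f :: "real \<Rightarrow> real"
  assumes f: "smooth_on {-\<epsilon><..<\<epsilon>} f" and \<epsilon>: "0 < \<epsilon>"
    and zero: "\<And>j. j < n \<Longrightarrow> (deriv ^^ j) f 0 = 0"
  shows "((\<lambda>t. f t / t ^ n) \<longlongrightarrow> (deriv ^^ n) f 0 / fact n) (at 0)"
  using f zero
proof (induction n arbitrary: f)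
  case 0
  then have "isCont f 0"
    using DERIV_isCont[OF DERIV_smooth_on[of _ f 0 0]] \<epsilon> by simp
  then show ?case by (simp add: isCont_def)
next
  case (Suc n)
  have shift: "(deriv ^^ k) (deriv f) = (deriv ^^ Suc k) f" for k
    by (simp add: funpow_swap1)
  have d: "(f has_real_derivative deriv f t) (at t)" if "t \<in> {-\<epsilon><..<\<epsilon>}" for t
    using DERIV_smooth_on[OF Suc.prems(1) that, of 0] by simp
  have "smooth_on {-\<epsilon><..<\<epsilon>} (deriv f)"
    using Suc.prems(1) unfolding smooth_on_def shift by blast
  moreover have "(deriv ^^ j) (deriv f) 0 = 0" if "j < n" for j
    unfolding shift using that by (intro Suc.prems(2)) simp
  ultimately have "((\<lambda>t. deriv f t / t ^ n) \<longlongrightarrow> (deriv ^^ Suc n) f 0 / fact n) (at 0)"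
    unfolding shift[symmetric] by (rule Suc.IH)
  then have "((\<lambda>t. deriv f t / t ^ n / real (Suc n)) \<longlongrightarrow>
      (deriv ^^ Suc n) f 0 / fact n / real (Suc n)) (at 0)"
    by (rule tendsto_divide) auto
  then have lim: "((\<lambda>t. deriv f t / (real (Suc n) * t ^ n)) \<longlongrightarrow>
      (deriv ^^ Suc n) f 0 / fact (Suc n)) (at 0)"
    by (simp add: mult.commute field_simps)
  have ev: "\<forall>\<^sub>F t in at 0. t \<in> {-\<epsilon><..<\<epsilon>}"
    using \<epsilon> by (intro eventually_at_in_open') auto
  have nz: "\<forall>\<^sub>F t in at (0::real). t \<noteq> 0"
    by (auto simp: eventually_at_filter)
  show ?case
  proof (rule lhopital[OF _ _ _ _ _ _ lim])
    have "isCont f 0" using d[of 0] \<epsilon> by (intro DERIV_isCont) auto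
    then show "(f \<longlongrightarrow> 0) (at 0)"
      using Suc.prems(2)[of 0] by (simp add: isCont_def)
    show "((\<lambda>t::real. t ^ Suc n) \<longlongrightarrow> 0) (at 0)"
      by (rule tendsto_eq_intros refl)+ simp
    show "\<forall>\<^sub>F t in at (0::real). t ^ Suc n \<noteq> 0"
      using nz by eventually_elim simp
    show "\<forall>\<^sub>F t in at (0::real). real (Suc n) * t ^ n \<noteq> 0"
      using nz by eventually_elim simp
    show "\<forall>\<^sub>F t in at 0. (f has_real_derivative deriv f t) (at t)"
      using ev by eventually_elim (rule d)
    show "\<forall>\<^sub>F t in at (0::real). ((\<lambda>t. t ^ Suc n) has_real_derivative real (Suc n) * t ^ n) (at t)"
      using DERIV_pow[of "Suc n"] by (intro always_eventually allI) simp
  qed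
qed

text \<open>
  For \<open>k \<le> n\<close> the quotient \<open>f t / t^k\<close> has the limit \<open>0^(n - k) B(0)\<close>. Once the lower derivatives
  are known to vanish, it also has the Taylor coefficient of order \<open>k\<close> as its limit. Only
  continuity of \<open>B\<close> enters, so its derivatives never have to be computed.
\<close>

lemma deriv_order_of_zero:
  fixes f B :: "real \<Rightarrow> real"
  assumes f: "smooth_on {-\<epsilon><..<\<epsilon>} f" and \<epsilon>: "0 < \<epsilon>"
    and eq: "\<And>t. t \<in> {-\<epsilon><..<\<epsilon>} \<Longrightarrow> f t = t ^ n * B t"
    and B: "isCont B 0" "B 0 \<noteq> 0"
  shows "(\<forall>k<n. (deriv ^^ k) f 0 = 0) \<and> (deriv ^^ n) f 0 \<noteq> 0"
proof -
  \<comment> \<open>Since \<open>0 ^ 0 = 1\<close>, the right-hand side is \<open>B 0\<close> for \<open>k = n\<close> and 0 for \<open>k < n\<close>.\<close>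
  have lim: "(deriv ^^ k) f 0 / fact k = 0 ^ (n - k) * B 0"
    if "k \<le> n" "\<And>j. j < k \<Longrightarrow> (deriv ^^ j) f 0 = 0" for k
  proof (rule LIM_unique)
    show "((\<lambda>t. f t / t ^ k) \<longlongrightarrow> (deriv ^^ k) f 0 / fact k) (at 0)"
      using f \<epsilon> that(2) by (rule taylor_quotient_tendsto)
    have "\<forall>\<^sub>F t in at 0. t \<in> {-\<epsilon><..<\<epsilon>} \<and> t \<noteq> 0"
      using \<epsilon> by (intro eventually_conj eventually_at_in_open') (auto simp: eventually_at_filter)
    then have "\<forall>\<^sub>F t in at 0. t ^ (n - k) * B t = f t / t ^ k"
    proof eventually_elim
      case (elim t)
      then show ?case using that(1) eq[of t] by (simp add: power_diff)
    qed
    moreover have "((\<lambda>t. t ^ (n - k) * B t) \<longlongrightarrow> 0 ^ (n - k) * B 0) (at 0)"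
      using B(1) unfolding isCont_def by (intro tendsto_intros)
    ultimately show "((\<lambda>t. f t / t ^ k) \<longlongrightarrow> 0 ^ (n - k) * B 0) (at 0)"
      by (rule Lim_transform_eventually[rotated])
  qed
  have below: "(deriv ^^ k) f 0 = 0" if "k < n" for k
    using that
  proof (induction k rule: less_induct)
    case (less k)
    then have "(deriv ^^ k) f 0 / fact k = 0 ^ (n - k) * B 0"
      by (intro lim) auto
    with less.prems show ?case by (simp add: power_0_left)
  qed
  moreover have "(deriv ^^ n) f 0 \<noteq> 0"
    using lim[of n, OF order_refl below] B(2) by auto
  ultimately show ?thesis by blast
qed

section \<open>The second derivative of the local parametrization\<close>

text \<open>
  \<open>B\<close> collects the factors of the Hessian determinant belonging to the other lines, together with
  \<open>W^3\<close> and the constant. The other linear factors are nonzero at \<open>t = 0\<close> because distinct lines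
  through the origin meet only there and the base point is not the origin.
\<close>

lemma level_param_second_deriv:
  assumes \<Phi>: "homogeneous m \<Phi>" and m: "2 \<le> m"
    and fac: "root_factorization (hessian_det \<Phi>) \<alpha>1 R \<omega> Q"
    and s: "s \<in> Fin ` R \<union> {Infty}"
    and par: "level_param \<Phi> s p \<epsilon> \<Psi>"
  obtains B where "isCont B 0" "B 0 \<noteq> 0"
    "\<And>t. t \<in> {-\<epsilon><..<\<epsilon>} \<Longrightarrow>
       deriv (deriv \<Psi>) t = t ^ (case s of Fin l \<Rightarrow> \<omega> l | Infty \<Rightarrow> \<alpha>1) * B t"
proof -
  let ?S = "{-\<epsilon><..<\<epsilon>}"
  let ?K = "(real m)\<^sup>2 * (real m - 1)"
  have \<epsilon>: "0 < \<epsilon>" and sm: "smooth_on ?S \<Psi>" and \<Psi>0: "\<Psi> 0 = base_coord s p"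
    and p: "p \<in> line s - {(0, 0)}"
    and lev: "\<And>t. t \<in> ?S \<Longrightarrow> rotated \<Phi> s (\<Psi> t) t = 1"
    using par unfolding level_param_def by auto
  have d1: "(\<Psi> has_real_derivative deriv \<Psi> t) (at t)" if "t \<in> ?S" for t
    using DERIV_smooth_on[OF sm that, of 0] by simp
  have d2: "(deriv \<Psi> has_real_derivative deriv (deriv \<Psi>) t) (at t)" if "t \<in> ?S" for t
    using DERIV_smooth_on[OF sm that, of 1] by simp
  have z: "0 \<in> ?S" using \<epsilon> by simp
  have c: "isCont \<Psi> 0" "isCont (deriv \<Psi>) 0"
    using d1[OF z] d2[OF z] by (auto intro: DERIV_isCont)
  have c_eval: "isCont (\<lambda>t. eval2 P (x t) (y t)) 0"
    if "(x has_real_derivative x') (at 0)" "(y has_real_derivative y') (at 0)" for P x y x' y'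
    using DERIV_eval2[OF that] by (rule DERIV_isCont)
  have fin: "finite R"
    and H: "hessian_det \<Phi> = X1 ^ \<alpha>1 * (\<Prod>l\<in>R. (X2 - Const l * X1) ^ \<omega> l) * Q"
    and Q: "\<And>u v. (u, v) \<noteq> (0, 0) \<Longrightarrow> eval2 Q u v \<noteq> 0"
    using fac unfolding root_factorization_def by blast+
  show thesis
  proof (cases s)
    case Infty
    define W where "W = (\<lambda>t. t * deriv \<Psi> t - \<Psi> t)"
    define B where "B = (\<lambda>t. (\<Prod>l\<in>R. (\<Psi> t - l * t) ^ \<omega> l) * eval2 Q t (\<Psi> t) * W t ^ 3 / ?K)"
    have key: "eval2 (hessian_det \<Phi>) t (\<Psi> t) * W t ^ 3 = ?K * deriv (deriv \<Psi>) t"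
      "W t \<noteq> 0" if t: "t \<in> ?S" for t
    proof -
      have "eval2 \<Phi> r (\<Psi> r) = 1" if "r \<in> ?S" for r
        using lev[OF that] by (simp add: Infty)
      note * = homogeneous_level_curve_hessian[OF \<Phi> m open_greaterThanLessThan t DERIV_ident d1
          DERIV_const d2[OF t] this]
      show "eval2 (hessian_det \<Phi>) t (\<Psi> t) * W t ^ 3 = ?K * deriv (deriv \<Psi>) t"
        using *(1) by (simp add: W_def)
      show "W t \<noteq> 0" using *(2) by (auto simp: W_def)
    qed
    show thesis
    proof (rule that)
      show "isCont B 0" unfolding B_def W_def
        using c m by (intro continuous_intros c_eval[OF DERIV_ident d1[OF z]]) auto
      have "\<Psi> 0 \<noteq> 0" using p \<Psi>0 Infty by (cases p) auto
      then show "B 0 \<noteq> 0"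
        using key(2)[OF z] m Q[of 0 "\<Psi> 0"] fin by (auto simp: B_def)
      show "deriv (deriv \<Psi>) t = t ^ (case s of Fin l \<Rightarrow> \<omega> l | Infty \<Rightarrow> \<alpha>1) * B t"
        if "t \<in> ?S" for t
      proof -
        have "?K \<noteq> 0" using m by simp
        then have "deriv (deriv \<Psi>) t = eval2 (hessian_det \<Phi>) t (\<Psi> t) * W t ^ 3 / ?K"
          unfolding key(1)[OF that] by (rule nonzero_mult_div_cancel_left[symmetric])
        also have "eval2 (hessian_det \<Phi>) t (\<Psi> t)
            = t ^ \<alpha>1 * ((\<Prod>l\<in>R. (\<Psi> t - l * t) ^ \<omega> l) * eval2 Q t (\<Psi> t))"
          by (simp only: H eval2_simps mult.assoc)
        finally show ?thesis
          by (simp only: Infty B_def slope.case mult.assoc times_divide_eq_right)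
      qed
    qed
  next
    case (Fin l)
    then have l: "l \<in> R" using s by auto
    define y where "y = (\<lambda>t. t + l * \<Psi> t)"
    define W where "W = (\<lambda>t. \<Psi> t * (1 + l * deriv \<Psi> t) - y t * deriv \<Psi> t)"
    define B where "B = (\<lambda>t. - (\<Psi> t ^ \<alpha>1 * (\<Prod>k\<in>R - {l}. (y t - k * \<Psi> t) ^ \<omega> k)
                               * eval2 Q (\<Psi> t) (y t) * W t ^ 3 / ?K))"
    have dy: "(y has_real_derivative 1 + l * deriv \<Psi> t) (at t)" if "t \<in> ?S" for t
      unfolding y_def using d1[OF that] by (auto intro!: derivative_eq_intros)
    have dy': "((\<lambda>t. 1 + l * deriv \<Psi> t) has_real_derivative l * deriv (deriv \<Psi>) t) (at t)"
      if "t \<in> ?S" for t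
      using d2[OF that] by (auto intro!: derivative_eq_intros)
    have key: "eval2 (hessian_det \<Phi>) (\<Psi> t) (y t) * W t ^ 3 = - ?K * deriv (deriv \<Psi>) t"
      "W t \<noteq> 0" if t: "t \<in> ?S" for t
    proof -
      have "eval2 \<Phi> (\<Psi> r) (y r) = 1" if "r \<in> ?S" for r
        using lev[OF that] by (simp add: Fin y_def)
      note * = homogeneous_level_curve_hessian[OF \<Phi> m open_greaterThanLessThan t d1 dy
          d2[OF t] dy'[OF t] this]
      show "eval2 (hessian_det \<Phi>) (\<Psi> t) (y t) * W t ^ 3 = - ?K * deriv (deriv \<Psi>) t"
        using *(1) by (simp add: W_def algebra_simps)
      show "W t \<noteq> 0" using *(2) by (auto simp: W_def)
    qed
    show thesis
    proof (rule that)
      have "isCont y 0" using dy[OF z] by (rule DERIV_isCont)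
      then show "isCont B 0" unfolding B_def W_def
        using c m by (intro continuous_intros c_eval[OF d1[OF z] dy[OF z]]) auto
      have "\<Psi> 0 \<noteq> 0" using p \<Psi>0 Fin by (cases p) auto
      then show "B 0 \<noteq> 0"
        using key(2)[OF z] m Q[of "\<Psi> 0" "y 0"] fin by (auto simp: B_def y_def)
      show "deriv (deriv \<Psi>) t = t ^ (case s of Fin l \<Rightarrow> \<omega> l | Infty \<Rightarrow> \<alpha>1) * B t"
        if "t \<in> ?S" for t
      proof -
        have "(\<Prod>k\<in>R. (y t - k * \<Psi> t) ^ \<omega> k)
            = t ^ \<omega> l * (\<Prod>k\<in>R - {l}. (y t - k * \<Psi> t) ^ \<omega> k)"
          using prod.remove[OF fin l, of "\<lambda>k. (y t - k * \<Psi> t) ^ \<omega> k"] by (simp add: y_def)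
        then have H_eq: "eval2 (hessian_det \<Phi>) (\<Psi> t) (y t)
            = t ^ \<omega> l * (\<Psi> t ^ \<alpha>1 * (\<Prod>k\<in>R - {l}. (y t - k * \<Psi> t) ^ \<omega> k)
                * eval2 Q (\<Psi> t) (y t))"
          by (simp only: H eval2_simps mult_ac)
        have "?K \<noteq> 0" using m by simp
        then have "- ?K \<noteq> 0" by (simp only: neg_equal_0_iff_equal not_False_eq_True)
        then have "deriv (deriv \<Psi>) t = eval2 (hessian_det \<Phi>) (\<Psi> t) (y t) * W t ^ 3 / - ?K"
          unfolding key(1)[OF that] by (rule nonzero_mult_div_cancel_left[symmetric])
        then show ?thesis
          by (simp only: H_eq Fin B_def slope.case mult.assoc times_divide_eq_right
              divide_minus_right mult_minus_right)
      qed
    qed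
  qed
qed

theorem proposition1p6:
  fixes m \<alpha>1 :: nat and \<Phi> Q :: bipoly and R :: "real set" and \<omega> :: "real \<Rightarrow> nat"
    and s :: slope and p :: "real \<times> real" and \<epsilon> :: real and \<Psi> :: "real \<Rightarrow> real"
  assumes "2 \<le> m" and "\<Phi> \<noteq> 0" and "homogeneous m \<Phi>"
    and "\<not> (\<exists>c a b. \<Phi> = Const c * (Const a * X1 + Const b * X2) ^ m)"
    and "root_factorization (hessian_det \<Phi>) \<alpha>1 R \<omega> Q"
    and "s \<in> Fin ` R \<union> {Infty}" and "s = Infty \<longrightarrow> 1 \<le> \<alpha>1"
    and "\<forall>(x1, x2) \<in> line s - {(0, 0)}. eval2 \<Phi> x1 x2 \<noteq> 0"
    and "level_param \<Phi> s p \<epsilon> \<Psi>"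
  shows "\<exists>M\<ge>2. (deriv ^^ M) \<Psi> 0 \<noteq> 0
           \<and> (\<forall>k. 2 \<le> k \<and> k < M \<longrightarrow> (deriv ^^ k) \<Psi> 0 = 0)
           \<and> M = (case s of Fin l \<Rightarrow> \<omega> l + 2 | Infty \<Rightarrow> \<alpha>1 + 2)"
proof -
  define n where "n = (case s of Fin l \<Rightarrow> \<omega> l | Infty \<Rightarrow> \<alpha>1)"
  obtain B where B: "isCont B 0" "B 0 \<noteq> 0"
    "\<And>t. t \<in> {-\<epsilon><..<\<epsilon>} \<Longrightarrow> deriv (deriv \<Psi>) t = t ^ n * B t"
    using level_param_second_deriv[OF assms(3,1,5,6,9)] unfolding n_def by blast
  have shift: "(deriv ^^ k) (deriv (deriv \<Psi>)) = (deriv ^^ (k + 2)) \<Psi>" for k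
    by (simp add: funpow_swap1)
  have "0 < \<epsilon>" "smooth_on {-\<epsilon><..<\<epsilon>} \<Psi>"
    using assms(9) by (auto simp: level_param_def)
  then have "smooth_on {-\<epsilon><..<\<epsilon>} (deriv (deriv \<Psi>))"
    unfolding smooth_on_def shift by blast
  from deriv_order_of_zero[OF this \<open>0 < \<epsilon>\<close> B(3) B(1,2)]
  have below: "\<forall>k<n. (deriv ^^ (k + 2)) \<Psi> 0 = 0" and at: "(deriv ^^ (n + 2)) \<Psi> 0 \<noteq> 0"
    unfolding shift by blast+
  have "(deriv ^^ k) \<Psi> 0 = 0" if "2 \<le> k" "k < n + 2" for k
  proof -
    have "k - 2 < n" "k - 2 + 2 = k" using that by auto
    with below show ?thesis by metis
  qed
  moreover have "n + 2 = (case s of Fin l \<Rightarrow> \<omega> l + 2 | Infty \<Rightarrow> \<alpha>1 + 2)"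
    by (simp add: n_def split: slope.split)
  ultimately show ?thesis using at by (intro exI[of _ "n + 2"]) auto
qed

end
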